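(* Let $A=\begin{pmatrix} a_{11} & a_{12}\\ a_{21} & a_{22}\end{pmatrix}$ be a real matrix and let $X=\begin{pmatrix} r\cos\theta\\ r\sin\theta\end{pmatrix}$ with $r\ge 0$ and $\theta\in\mathbb{R} \pmod{2\pi}$. Then the vector $AX\in\mathbb{R}^2$ can be decomposed into components parallel and orthogonal to $X$ by $$AX=\mathcal{R}(\theta)X+\mathcal{T}(\theta)X^\perp,$$ where $\mathcal{R}(\theta)$ and $\mathcal{T}(\theta)$ are the real-valued functions $$\mathcal{R}(\theta)=m_R+p\cos(2(\theta-\theta_R)),\qquad \mathcal{T}(\theta)=m_T-p\sin(2(\theta-\theta_R)),$$ with $$m_R=\tfrac12(a_{11}+a_{22}),\qquad m_T=\tfrac12(a_{21}-a_{12}),\qquad p=\tfrac12\sqrt{(a_{11}-a_{22})^2+(a_{12}+a_{21})^2},$$ and, if $p\neq 0$, $$\theta_R=\tfrac12\arctan(a_{12}+a_{21},\,a_{11}-a_{22})\in\mathbb{R}\pmod{\pi}.$$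
   Context: For $X=\begin{pmatrix} x_1 \\ x_2 \end{pmatrix}\in\mathbb{R}^2$, $X^\perp=\begin{pmatrix} -x_2 \\ x_1 \end{pmatrix}$ is the counter-clockwise rotation of $X$ by $\pi/2$. The two-argument function $\arctan(y,x)\in\mathbb{R}\pmod{2\pi}$ denotes the polar angle of the point $(x,y)\neq(0,0)$. When $p=0$ the value of $\theta_R$ is irrelevant, and $\mathcal{R}\equiv m_R$, $\mathcal{T}\equiv m_T$. *)

theory Defs
  imports "HOL-Analysis.Analysis"
begin

definition perp :: "real^2 \<Rightarrow> real^2" where
  "perp X = vector [- (X $ 2), X $ 1]"

text \<open>The two-argument arctangent takes values in the reals modulo \<open>2\<pi>\<close>. Such a class is represented
  by the set of all its real representatives. Note the argument order: \<open>arctan2 y x\<close> belongs to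
  the point \<open>(x, y)\<close>; it is only meaningful for \<open>(x, y) \<noteq> (0, 0)\<close>.\<close>

definition arctan2 :: "real \<Rightarrow> real \<Rightarrow> real set" where
  "arctan2 y x = {\<phi>. is_Arg (Complex x y) \<phi>}"

lemma arctan2_eq_coset:
  assumes "(x, y) \<noteq> (0, 0)"
  shows "arctan2 y x = {Arg (Complex x y) + 2 * pi * of_int k | k. True}"
proof -
  have nz: "Complex x y \<noteq> 0"
    using assms by (simp add: complex_eq_iff)
  have "is_Arg (Complex x y) \<phi> \<longleftrightarrow> (\<exists>k::int. \<phi> = Arg (Complex x y) + 2 * pi * of_int k)" for \<phi>
  proof
    assume "is_Arg (Complex x y) \<phi>"
    then have "Complex x y = of_real (norm (Complex x y)) * exp (\<i> * of_real \<phi>)"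
      by (simp add: is_Arg_def)
    moreover have "Complex x y = of_real (norm (Complex x y)) * exp (\<i> * of_real (Arg (Complex x y)))"
      using Arg_eq nz by blast
    ultimately have "exp (\<i> * of_real \<phi>) = exp (\<i> * of_real (Arg (Complex x y)))"
      using nz by (metis mult_cancel_left mult_zero_left)
    then obtain n :: int where
      "\<i> * of_real \<phi> = \<i> * of_real (Arg (Complex x y)) + (of_int (2 * n) * pi) * \<i>"
      by (auto simp: exp_eq)
    then have "\<phi> = Arg (Complex x y) + 2 * pi * of_int n"
      by (auto simp: complex_eq_iff)
    then show "\<exists>k::int. \<phi> = Arg (Complex x y) + 2 * pi * of_int k" by blast
  next
    assume "\<exists>k::int. \<phi> = Arg (Complex x y) + 2 * pi * of_int k"
    then show "is_Arg (Complex x y) \<phi>"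
      by (metis is_Arg_2pi_iff is_Arg_Arg nz mult.commute mult.assoc)
  qed
  then show ?thesis
    by (auto simp: arctan2_def)
qed

definition m_R :: "real^2^2 \<Rightarrow> real" where
  "m_R A = 1/2 * (A $ 1 $ 1 + A $ 2 $ 2)"

definition m_T :: "real^2^2 \<Rightarrow> real" where
  "m_T A = 1/2 * (A $ 2 $ 1 - A $ 1 $ 2)"

definition p_ampl :: "real^2^2 \<Rightarrow> real" where
  "p_ampl A = 1/2 * sqrt ((A $ 1 $ 1 - A $ 2 $ 2)\<^sup>2 + (A $ 1 $ 2 + A $ 2 $ 1)\<^sup>2)"

text \<open>The set of representatives of \<open>\<theta>\<^sub>R\<close>. Halving a class modulo \<open>2\<pi>\<close> gives a class modulo \<open>\<pi>\<close>.\<close>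

definition theta_R :: "real^2^2 \<Rightarrow> real set" where
  "theta_R A = (\<lambda>\<phi>. 1/2 * \<phi>) ` arctan2 (A $ 1 $ 2 + A $ 2 $ 1) (A $ 1 $ 1 - A $ 2 $ 2)"

text \<open>The argument \<open>\<theta>\<^sub>R\<close> is a chosen representative.\<close>

definition R_fun :: "real^2^2 \<Rightarrow> real \<Rightarrow> real \<Rightarrow> real" where
  "R_fun A \<theta>\<^sub>R \<theta> = m_R A + p_ampl A * cos (2 * (\<theta> - \<theta>\<^sub>R))"

definition T_fun :: "real^2^2 \<Rightarrow> real \<Rightarrow> real \<Rightarrow> real" where
  "T_fun A \<theta>\<^sub>R \<theta> = m_T A - p_ampl A * sin (2 * (\<theta> - \<theta>\<^sub>R))"

lemma theta_R_eq_coset: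
  assumes "p_ampl A \<noteq> 0"
  shows "\<exists>\<theta>\<^sub>0. theta_R A = {\<theta>\<^sub>0 + pi * of_int k | k. True}"
proof -
  have "(A $ 1 $ 1 - A $ 2 $ 2, A $ 1 $ 2 + A $ 2 $ 1) \<noteq> (0, 0)"
    using assms by (auto simp: p_ampl_def)
  from arctan2_eq_coset[OF this] have "theta_R A =
      {1/2 * Arg (Complex (A $ 1 $ 1 - A $ 2 $ 2) (A $ 1 $ 2 + A $ 2 $ 1)) + pi * of_int k | k. True}"
    unfolding theta_R_def by (auto simp: image_iff algebra_simps)
  then show ?thesis by blast
qed

lemma R_T_fun_well_defined:
  fixes k l :: int
  shows "R_fun A (\<theta>\<^sub>R + pi * of_int k) (\<theta> + 2 * pi * of_int l) = R_fun A \<theta>\<^sub>R \<theta>"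
    and "T_fun A (\<theta>\<^sub>R + pi * of_int k) (\<theta> + 2 * pi * of_int l) = T_fun A \<theta>\<^sub>R \<theta>"
proof -
  have *: "2 * ((\<theta> + 2 * pi * of_int l) - (\<theta>\<^sub>R + pi * of_int k))
      = 2 * (\<theta> - \<theta>\<^sub>R) + 2 * pi * of_int (2 * l - k)"
    by (simp add: algebra_simps)
  have "cos (x + 2 * pi * of_int n) = cos x" "sin (x + 2 * pi * of_int n) = sin x" for x and n :: int
    by (simp_all add: cos_add sin_add)
  then show "R_fun A (\<theta>\<^sub>R + pi * of_int k) (\<theta> + 2 * pi * of_int l) = R_fun A \<theta>\<^sub>R \<theta>"
    and "T_fun A (\<theta>\<^sub>R + pi * of_int k) (\<theta> + 2 * pi * of_int l) = T_fun A \<theta>\<^sub>R \<theta>"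
    unfolding R_fun_def T_fun_def * by (simp_all only:)
qed

end

theory Submission
  imports Defs
begin

text \<open>
  Halving the angle is exactly what makes \<open>p cos 2\<theta>\<^sub>R\<close> and \<open>p sin 2\<theta>\<^sub>R\<close> the two coordinates of the
  trace-free symmetric part of \<open>A\<close>. That part sends the unit vector of angle \<open>\<theta>\<close> to the vector of
  length \<open>p\<close> and angle \<open>2\<theta>\<^sub>R - \<theta>\<close>, whose components along the vector and its rotation are
  \<open>p cos (2(\<theta> - \<theta>\<^sub>R))\<close> and \<open>-p sin (2(\<theta> - \<theta>\<^sub>R))\<close>; the remaining part of \<open>A\<close> is \<open>m\<^sub>R\<close> times the
  identity plus \<open>m\<^sub>T\<close> times the quarter turn.
\<close>

text \<open>These are the real and imaginary parts of the polar form that \<open>is_Arg\<close>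
  asserts; \<open>sqrt (x\<^sup>2 + y\<^sup>2)\<close> is the modulus.\<close>

lemma arctan2_polar:
  assumes "\<phi> \<in> arctan2 y x"
  shows "sqrt (x\<^sup>2 + y\<^sup>2) * cos \<phi> = x" "sqrt (x\<^sup>2 + y\<^sup>2) * sin \<phi> = y"
proof -
  have "Complex x y = of_real (sqrt (x\<^sup>2 + y\<^sup>2)) * cis \<phi>"
    using assms by (simp add: arctan2_def is_Arg_def cis_conv_exp complex_norm)
  then show "sqrt (x\<^sup>2 + y\<^sup>2) * cos \<phi> = x" "sqrt (x\<^sup>2 + y\<^sup>2) * sin \<phi> = y"
    by (simp_all add: complex_eq_iff)
qed

text \<open>Doubling undoes the halving in \<open>theta_R\<close>. If \<open>p_ampl A\<close> is 0,
  both right-hand sides vanish as well, so any \<open>\<theta>\<^sub>R\<close> will do.\<close>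

lemma p_ampl_theta_R:
  assumes "p_ampl A \<noteq> 0 \<longrightarrow> \<theta>\<^sub>R \<in> theta_R A"
  shows "p_ampl A * cos (2 * \<theta>\<^sub>R) = (A $ 1 $ 1 - A $ 2 $ 2) / 2"
    and "p_ampl A * sin (2 * \<theta>\<^sub>R) = (A $ 1 $ 2 + A $ 2 $ 1) / 2"
proof -
  let ?x = "A $ 1 $ 1 - A $ 2 $ 2" and ?y = "A $ 1 $ 2 + A $ 2 $ 1"
  have "p_ampl A * cos (2 * \<theta>\<^sub>R) = ?x / 2 \<and> p_ampl A * sin (2 * \<theta>\<^sub>R) = ?y / 2"
  proof (cases "p_ampl A = 0")
    case True
    then have "?x = 0 \<and> ?y = 0"
      by (simp add: p_ampl_def sum_power2_eq_zero_iff)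
    then show ?thesis
      using True by simp
  next
    case False
    then have "2 * \<theta>\<^sub>R \<in> arctan2 ?y ?x"
      using assms by (auto simp: theta_R_def)
    from arctan2_polar[OF this] show ?thesis
      by (simp add: p_ampl_def)
  qed
  then show "p_ampl A * cos (2 * \<theta>\<^sub>R) = ?x / 2" "p_ampl A * sin (2 * \<theta>\<^sub>R) = ?y / 2"
    by blast+
qed

lemma orthogonal_perp: "orthogonal X (perp X)"
  by (simp add: orthogonal_def perp_def inner_vec_def sum_2)

text \<open>The two coordinates of the decomposition for a unit vector; a general radius only
  contributes a common factor.\<close>

lemma matrix_polar_components:
  assumes "p_ampl A \<noteq> 0 \<longrightarrow> \<theta>\<^sub>R \<in> theta_R A"
  shows "A $ 1 $ 1 * cos \<theta> + A $ 1 $ 2 * sin \<theta> = R_fun A \<theta>\<^sub>R \<theta> * cos \<theta> - T_fun A \<theta>\<^sub>R \<theta> * sin \<theta>"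
    and "A $ 2 $ 1 * cos \<theta> + A $ 2 $ 2 * sin \<theta> = R_fun A \<theta>\<^sub>R \<theta> * sin \<theta> + T_fun A \<theta>\<^sub>R \<theta> * cos \<theta>"
proof -
  let ?p = "p_ampl A" and ?\<alpha> = "2 * (\<theta> - \<theta>\<^sub>R)"
  \<comment> \<open>The difference \<open>?\<alpha> - \<theta>\<close> equals
    \<open>-(2 * \<theta>\<^sub>R - \<theta>)\<close>, and cosine is even.\<close>
  have "?p * (cos ?\<alpha> * cos \<theta> + sin ?\<alpha> * sin \<theta>) = ?p * cos (2 * \<theta>\<^sub>R - \<theta>)"
    using cos_diff[of ?\<alpha> \<theta>] cos_minus[of "2 * \<theta>\<^sub>R - \<theta>"] by simp
  also have "\<dots> = ?p * cos (2 * \<theta>\<^sub>R) * cos \<theta> + ?p * sin (2 * \<theta>\<^sub>R) * sin \<theta>"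
    by (simp add: cos_diff distrib_left)
  finally have c: "?p * (cos ?\<alpha> * cos \<theta> + sin ?\<alpha> * sin \<theta>)
      = (A $ 1 $ 1 - A $ 2 $ 2) / 2 * cos \<theta> + (A $ 1 $ 2 + A $ 2 $ 1) / 2 * sin \<theta>"
    by (simp only: p_ampl_theta_R[OF assms])
  have "?p * (cos ?\<alpha> * sin \<theta> - sin ?\<alpha> * cos \<theta>) = ?p * sin (2 * \<theta>\<^sub>R - \<theta>)"
    using sin_diff[of \<theta> ?\<alpha>] by (simp add: mult.commute)
  also have "\<dots> = ?p * sin (2 * \<theta>\<^sub>R) * cos \<theta> - ?p * cos (2 * \<theta>\<^sub>R) * sin \<theta>"
    by (simp add: sin_diff right_diff_distrib)
  finally have s: "?p * (cos ?\<alpha> * sin \<theta> - sin ?\<alpha> * cos \<theta>)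
      = (A $ 1 $ 2 + A $ 2 $ 1) / 2 * cos \<theta> - (A $ 1 $ 1 - A $ 2 $ 2) / 2 * sin \<theta>"
    by (simp only: p_ampl_theta_R[OF assms])
  \<comment> \<open>Together with \<open>c\<close> and \<open>s\<close>, the \<open>m_R\<close>
    terms restore the diagonal entries and the \<open>m_T\<close> terms the off-diagonal ones; what
    remains is linear in the products with \<open>cos \<theta>\<close> and
    \<open>sin \<theta>\<close>.\<close>
  show "A $ 1 $ 1 * cos \<theta> + A $ 1 $ 2 * sin \<theta> = R_fun A \<theta>\<^sub>R \<theta> * cos \<theta> - T_fun A \<theta>\<^sub>R \<theta> * sin \<theta>"
    using c unfolding R_fun_def T_fun_def m_R_def m_T_def by argo
  show "A $ 2 $ 1 * cos \<theta> + A $ 2 $ 2 * sin \<theta> = R_fun A \<theta>\<^sub>R \<theta> * sin \<theta> + T_fun A \<theta>\<^sub>R \<theta> * cos \<theta>"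
    using s unfolding R_fun_def T_fun_def m_R_def m_T_def by argo
qed

theorem theorem2p2:
  fixes A :: "real^2^2" and X :: "real^2" and r \<theta> \<theta>\<^sub>R :: real
  assumes "r \<ge> 0"
    and "X = vector [r * cos \<theta>, r * sin \<theta>]"
    and "p_ampl A \<noteq> 0 \<longrightarrow> \<theta>\<^sub>R \<in> theta_R A"
  shows "A *v X = R_fun A \<theta>\<^sub>R \<theta> *\<^sub>R X + T_fun A \<theta>\<^sub>R \<theta> *\<^sub>R perp X \<and> orthogonal X (perp X)"
proof -
  let ?R = "R_fun A \<theta>\<^sub>R \<theta>" and ?T = "T_fun A \<theta>\<^sub>R \<theta>"
  have X: "X $ 1 = r * cos \<theta>" "X $ 2 = r * sin \<theta>"
    using assms(2) by simp_all
  have "(A *v X) $ 1 = r * (A $ 1 $ 1 * cos \<theta> + A $ 1 $ 2 * sin \<theta>)"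
    "(A *v X) $ 2 = r * (A $ 2 $ 1 * cos \<theta> + A $ 2 $ 2 * sin \<theta>)"
    by (simp_all add: matrix_vector_mult_def sum_2 X algebra_simps)
  moreover have "(?R *\<^sub>R X + ?T *\<^sub>R perp X) $ 1 = r * (?R * cos \<theta> - ?T * sin \<theta>)"
    "(?R *\<^sub>R X + ?T *\<^sub>R perp X) $ 2 = r * (?R * sin \<theta> + ?T * cos \<theta>)"
    by (simp_all add: perp_def X algebra_simps)
  ultimately have "A *v X = ?R *\<^sub>R X + ?T *\<^sub>R perp X"
    by (simp only: vec_eq_iff forall_2 matrix_polar_components[OF assms(3)])
  then show ?thesis
    using orthogonal_perp by blast
qed

end
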